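(* Suppose that $\mathbb X$ is unimodular. Then the point-shift $\mathfrak H$ preserves $\mathbf P^{\mathfrak m}$ if and only if $\mathfrak H$ is bijective. That is, $\mathbf P^{\mathfrak m}(\theta_{\mathfrak h}^{-1}\in A)=\mathbf P^{\mathfrak m}(A)$ for all $A\in\mathcal A$ if and only if $\mathfrak H$ is bijective.
   Context: $\mathbb X$ is a locally compact second-countable Hausdorff topological group with neutral element $e$, Borel sets $\mathcal B(\mathbb X)$ and a fixed left-invariant Haar measure $\lambda$; unimodular means $\lambda$ is also right-invariant. $(\Omega,\mathcal A,\theta,\mathbf P)$ is a stationary framework on $\mathbb X$: $(\Omega,\mathcal A,\mathbf P)$ is a probability space and $\theta:\mathbb X\times\Omega\to\Omega$, $\theta_x\omega:=\theta(x,\omega)$, is a (jointly) measurable left action of $\mathbb X$ preserving $\mathbf P$. $\mathfrak m$ is a simple point process (random locally finite counting measure on $\mathbb X$ with all atoms of mass $1$, identified with its support) that is flow-adapted: $\mathfrak m(\theta_x\omega,B)=\mathfrak m(\omega,x^{-1}B)$ for all $x\in\mathbb X,\omega\in\Omega,B\in\mathcal B(\mathbb X)$; its intensity $\gamma=\mathbf E[\mathfrak m(B)]/\lambda(B)$ (for any $B$ with $\lambda(B)\in(0,\infty)$) lies in $(0,\infty)$. The Palm probability measure is $\mathbf P^{\mathfrak m}(A):=\frac1\gamma\mathbf E\int_{\mathbb X}1_{\theta_x^{-1}\omega\in A}w(x)\,\mathfrak m(dx)$, for any measurable $w:\mathbb X\to[0,\infty)$ with $\int w\,d\lambda=1$.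 $\mathfrak H$ is a point-shift on $\mathfrak m$: a measurable map $\mathfrak H:\Omega\times\mathbb X\to\mathbb X$ such that for $\mathbf P$-a.e. $\omega$, $\mathfrak H(\omega,X)\in\mathfrak m(\omega)$ for all $X\in\mathfrak m(\omega)$, which is flow-adapted: $\mathfrak H(\theta_y\omega,yx)=y\mathfrak H(\omega,x)$ for all $x,y\in\mathbb X$, $\omega\in\Omega$ (with $\mathfrak H(\omega,x):=x$ for $x\notin\mathfrak m(\omega)$). Its point-map is $\mathfrak h(\omega):=\mathfrak H(\omega,e)$, and $\theta_{\mathfrak h}^{-1}$ denotes the map $\omega\mapsto\theta_{\mathfrak h(\omega)}^{-1}\omega$. $\mathfrak H$ is bijective if for $\mathbf P$-a.e. $\omega$, $\mathfrak H(\omega,\cdot)$ is a bijection of the support of $\mathfrak m(\omega)$. *)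

theory Defs
  imports "HOL-Probability.Probability"
begin

text \<open>
  The group is a type of sort \<open>topological_group_add\<close>, written additively but not assumed to be
  commutative: the neutral element is \<open>0\<close>, the product \<open>x y\<close> is \<open>x + y\<close> and
  \<open>x\<inverse>\<close> is \<open>- x\<close>. Its Borel sets are \<open>sets borel\<close>.
\<close>

text \<open>
  Regularity is not required in the next definition: on a locally compact second-countable
  Hausdorff space every Borel measure that is finite on compact sets is regular.
\<close>

definition left_haar_measure :: "'x::topological_group_add measure \<Rightarrow> bool" where
  "left_haar_measure \<nu> \<longleftrightarrow>
     sets \<nu> = sets borel \<and>
     emeasure \<nu> UNIV \<noteq> 0 \<and>
     (\<forall>K. compact K \<longrightarrow> emeasure \<nu> K < \<infinity>) \<and>
     (\<forall>x. \<forall>B\<in>sets borel. emeasure \<nu> ((\<lambda>y. x + y) ` B) = emeasure \<nu> B)"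

definition right_invariant :: "'x::topological_group_add measure \<Rightarrow> bool" where
  "right_invariant \<nu> \<longleftrightarrow>
     (\<forall>x. \<forall>B\<in>sets borel. emeasure \<nu> ((\<lambda>y. y + x) ` B) = emeasure \<nu> B)"

definition stationary_framework ::
    "'w measure \<Rightarrow> ('x::topological_group_add \<Rightarrow> 'w \<Rightarrow> 'w) \<Rightarrow> bool" where
  "stationary_framework P \<theta> \<longleftrightarrow>
     prob_space P \<and>
     (\<lambda>(x, \<omega>). \<theta> x \<omega>) \<in> borel \<Otimes>\<^sub>M P \<rightarrow>\<^sub>M P \<and>
     (\<forall>\<omega>\<in>space P. \<theta> 0 \<omega> = \<omega>) \<and>
     (\<forall>x y. \<forall>\<omega>\<in>space P. \<theta> (x + y) \<omega> = \<theta> x (\<theta> y \<omega>)) \<and>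
     (\<forall>x. distr P P (\<theta> x) = P)"

definition simple_counting_measure :: "'x::topological_space measure \<Rightarrow> bool" where
  "simple_counting_measure \<mu> \<longleftrightarrow>
     sets \<mu> = sets borel \<and>
     (\<forall>K. compact K \<longrightarrow> emeasure \<mu> K < \<infinity>) \<and>
     (\<exists>S. \<forall>B\<in>sets borel. emeasure \<mu> B = emeasure (count_space UNIV) (S \<inter> B))"

text \<open>
  For a simple counting measure on a Hausdorff space the set \<open>S\<close> of the previous definition is the set of atoms, and
  it is the topological support when the space is moreover locally compact.
\<close>

definition atoms :: "'x measure \<Rightarrow> 'x set" where
  "atoms \<mu> = {x. emeasure \<mu> {x} \<noteq> 0}"

definition simple_point_process ::
    "'w measure \<Rightarrow> ('w \<Rightarrow> 'x::topological_space measure) \<Rightarrow> bool" where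
  "simple_point_process P m \<longleftrightarrow>
     (\<forall>\<omega>\<in>space P. simple_counting_measure (m \<omega>)) \<and>
     (\<forall>B\<in>sets borel. (\<lambda>\<omega>. emeasure (m \<omega>) B) \<in> borel_measurable P)"

definition flow_adapted ::
    "'w measure \<Rightarrow> ('x::topological_group_add \<Rightarrow> 'w \<Rightarrow> 'w) \<Rightarrow> ('w \<Rightarrow> 'x measure) \<Rightarrow> bool" where
  "flow_adapted P \<theta> m \<longleftrightarrow>
     (\<forall>x. \<forall>\<omega>\<in>space P. \<forall>B\<in>sets borel.
        emeasure (m (\<theta> x \<omega>)) B = emeasure (m \<omega>) ((\<lambda>y. - x + y) ` B))"

definition intensity ::
    "'w measure \<Rightarrow> ('w \<Rightarrow> 'x measure) \<Rightarrow> 'x measure \<Rightarrow> 'x set \<Rightarrow> ennreal" where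
  "intensity P m \<nu> B = (\<integral>\<^sup>+\<omega>. emeasure (m \<omega>) B \<partial>P) / emeasure \<nu> B"

text \<open>
  Here \<open>\<gamma>\<close> is the intensity and \<open>w\<close> a weight function of Haar integral 1. Under
  stationarity neither the choice of \<open>w\<close> here nor the choice of the reference set \<open>B\<close> (with
  positive finite Haar measure) in \<open>intensity\<close> matters.
\<close>

definition palm_measure ::
    "'w measure \<Rightarrow> ('x::topological_group_add \<Rightarrow> 'w \<Rightarrow> 'w) \<Rightarrow> ('w \<Rightarrow> 'x measure) \<Rightarrow> ennreal \<Rightarrow>
      ('x \<Rightarrow> real) \<Rightarrow> 'w measure" where
  "palm_measure P \<theta> m \<gamma> w = measure_of (space P) (sets P)
     (\<lambda>A. (\<integral>\<^sup>+\<omega>. (\<integral>\<^sup>+x. indicator A (\<theta> (- x) \<omega>) * ennreal (w x) \<partial>m \<omega>) \<partial>P) / \<gamma>)"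

definition point_shift ::
    "'w measure \<Rightarrow> ('x::topological_group_add \<Rightarrow> 'w \<Rightarrow> 'w) \<Rightarrow> ('w \<Rightarrow> 'x measure) \<Rightarrow>
      ('w \<Rightarrow> 'x \<Rightarrow> 'x) \<Rightarrow> bool" where
  "point_shift P \<theta> m H \<longleftrightarrow>
     (\<lambda>(\<omega>, x). H \<omega> x) \<in> P \<Otimes>\<^sub>M borel \<rightarrow>\<^sub>M borel \<and>
     (AE \<omega> in P. \<forall>x\<in>atoms (m \<omega>). H \<omega> x \<in> atoms (m \<omega>)) \<and>
     (\<forall>\<omega>\<in>space P. \<forall>x y. H (\<theta> y \<omega>) (y + x) = y + H \<omega> x) \<and>
     (\<forall>\<omega>\<in>space P. \<forall>x. x \<notin> atoms (m \<omega>) \<longrightarrow> H \<omega> x = x)"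

definition point_map :: "('w \<Rightarrow> 'x::topological_group_add \<Rightarrow> 'x) \<Rightarrow> 'w \<Rightarrow> 'x" where
  "point_map H \<omega> = H \<omega> 0"

definition bijective_point_shift ::
    "'w measure \<Rightarrow> ('w \<Rightarrow> 'x measure) \<Rightarrow> ('w \<Rightarrow> 'x \<Rightarrow> 'x) \<Rightarrow> bool" where
  "bijective_point_shift P m H \<longleftrightarrow>
     (AE \<omega> in P. bij_betw (H \<omega>) (atoms (m \<omega>)) (atoms (m \<omega>)))"

text \<open>
  The set function in the definition of the Palm measure is a measure, so that
  \<^const>\<open>measure_of\<close> does not collapse it to the null measure.
\<close>

lemma countable_disjoint_relatively_compact_cover:
  assumes lc: "locally_compact_space (euclidean :: 'x::{second_countable_topology, t2_space} topology)"
  obtains D :: "nat \<Rightarrow> 'x::{second_countable_topology, t2_space} set" where "disjoint_family D" "(\<Union>n. D n) = UNIV"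
    "\<And>n. D n \<in> sets borel" "\<And>n. \<exists>K. compact K \<and> D n \<subseteq> K"
proof -
  obtain BB :: "'x set set" where BB: "countable BB" "topological_basis BB"
    using ex_countable_basis by blast
  define CC where "CC = insert {} {B\<in>BB. \<exists>K. compact K \<and> B \<subseteq> K}"
  have cc: "countable CC" "CC \<noteq> {}" using BB(1) by (auto simp: CC_def)
  have cov: "\<Union>CC = UNIV"
  proof -
    have "\<exists>C\<in>CC. x \<in> C" for x
    proof -
      obtain U K where UK: "open U" "compact K" "x \<in> U" "U \<subseteq> K"
        using lc unfolding locally_compact_space_def by simp (metis (no_types))
      obtain B where "B \<in> BB" "x \<in> B" "B \<subseteq> U"
        using topological_basisE[OF BB(2) UK(1) UK(3)] by blast
      then show ?thesis using UK by (auto simp: CC_def)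
    qed
    then show ?thesis by auto
  qed
  have op: "open C" "\<exists>K. compact K \<and> C \<subseteq> K" if "C \<in> CC" for C
    using that topological_basis_open[OF BB(2)] by (auto simp: CC_def)
  define E where "E = from_nat_into CC"
  have E: "E n \<in> CC" for n using cc(2) by (simp add: E_def from_nat_into)
  have "range E = CC" using cc by (simp add: E_def range_from_nat_into)
  then have UE: "(\<Union>n. E n) = UNIV" using cov by simp
  show thesis
  proof
    show "disjoint_family (disjointed E)" by (rule disjoint_family_disjointed)
    show "(\<Union>n. disjointed E n) = UNIV" using UE by (simp add: UN_disjointed_eq)
    show "disjointed E n \<in> sets borel" for n
      using op(1)[OF E] by (auto simp: disjointed_def intro!: sets.Diff sets.finite_UN)
    show "\<exists>K. compact K \<and> disjointed E n \<subseteq> K" for n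
      using op(2)[OF E[of n]] disjointed_subset[of E n] by blast
  qed
qed

lemma measurable_nn_integral_simple_point_process:
  fixes m :: "'w \<Rightarrow> 'x::{second_countable_topology, t2_space} measure"
  assumes lc: "locally_compact_space (euclidean :: 'x topology)"
    and m: "simple_point_process P m"
    and f[measurable]: "(\<lambda>(\<omega>, x). f \<omega> x) \<in> borel_measurable (P \<Otimes>\<^sub>M borel)"
  shows "(\<lambda>\<omega>. \<integral>\<^sup>+x. f \<omega> x \<partial>m \<omega>) \<in> borel_measurable P"
proof -
  obtain D :: "nat \<Rightarrow> 'x set" where D: "disjoint_family D" "(\<Union>n. D n) = UNIV"
      "\<And>n. D n \<in> sets borel" "\<And>n. \<exists>K. compact K \<and> D n \<subseteq> K"
    using countable_disjoint_relatively_compact_cover[OF lc] by metis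
  note [measurable] = D(3)
  have sm: "sets (m \<omega>) = sets borel" if "\<omega> \<in> space P" for \<omega>
    using m that by (simp add: simple_point_process_def simple_counting_measure_def)
  have em[measurable]: "(\<lambda>\<omega>. emeasure (m \<omega>) B) \<in> borel_measurable P" if "B \<in> sets borel" for B
    using m that by (simp add: simple_point_process_def)
  have fin: "emeasure (m \<omega>) (D n) < \<infinity>" if w: "\<omega> \<in> space P" for \<omega> n
  proof -
    obtain K where K: "compact K" "D n \<subseteq> K" using D(4) by blast
    have "K \<in> sets (m \<omega>)" using K(1) sm[OF w] by (simp add: borel_closed compact_imp_closed)
    then have "emeasure (m \<omega>) (D n) \<le> emeasure (m \<omega>) K" using K(2) by (rule emeasure_mono[rotated])
    also have "\<dots> < \<infinity>"
      using m w K(1) by (simp add: simple_point_process_def simple_counting_measure_def)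
    finally show ?thesis .
  qed
  define c where "c n \<omega> = 1 + emeasure (m \<omega>) (D n)" for n \<omega>
  have c[measurable]: "c n \<in> borel_measurable P" for n unfolding c_def by measurable
  have c0: "c n \<omega> \<noteq> 0" for n \<omega>
    by (simp add: c_def add_eq_0_iff_both_eq_0)
  have cfin: "c n \<omega> \<noteq> \<top>" if "\<omega> \<in> space P" for n \<omega>
    using fin[OF that, of n] by (auto simp: c_def ennreal_add_eq_top)
  define L where "L n \<omega> = density (m \<omega>) (\<lambda>x. indicator (D n) x / c n \<omega>)" for n \<omega>
  have meas: "g \<in> borel_measurable (m \<omega>)"
    if "\<omega> \<in> space P" "g \<in> borel_measurable borel" for \<omega> and g :: "'x \<Rightarrow> ennreal"
    using that(2) by (simp add: measurable_cong_sets[OF sm[OF that(1)] refl])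
  have eL: "emeasure (L n \<omega>) B = emeasure (m \<omega>) (D n \<inter> B) / c n \<omega>"
    if w: "\<omega> \<in> space P" and B: "B \<in> sets borel" for n \<omega> B
  proof -
    have "emeasure (L n \<omega>) B = (\<integral>\<^sup>+x. indicator (D n) x / c n \<omega> * indicator B x \<partial>m \<omega>)"
      unfolding L_def using B by (intro emeasure_density meas[OF w]) (auto simp: sm[OF w])
    also have "\<dots> = (\<integral>\<^sup>+x. indicator (D n \<inter> B) x / c n \<omega> \<partial>m \<omega>)"
      by (intro nn_integral_cong) (auto split: split_indicator)
    also have "\<dots> = emeasure (m \<omega>) (D n \<inter> B) / c n \<omega>"
      using B by (subst nn_integral_divide) (auto intro!: meas[OF w] simp: sm[OF w])
    finally show ?thesis .
  qed
  have L: "L n \<in> P \<rightarrow>\<^sub>M subprob_algebra borel" for n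
  proof (rule measurable_subprob_algebra)
    fix \<omega> assume w: "\<omega> \<in> space P"
    show sL: "sets (L n \<omega>) = sets borel" by (simp add: L_def sm[OF w])
    show "subprob_space (L n \<omega>)"
    proof
      have "space (L n \<omega>) = UNIV" using sets_eq_imp_space_eq[OF sL] by simp
      then show "space (L n \<omega>) \<noteq> {}" by simp
      have "emeasure (L n \<omega>) UNIV = emeasure (m \<omega>) (D n) / c n \<omega>" using eL[OF w, of UNIV] by simp
      also have "\<dots> \<le> c n \<omega> / c n \<omega>" by (intro divide_right_mono_ennreal) (simp add: c_def)
      also have "\<dots> = 1" using c0 cfin[OF w] by (intro ennreal_divide_self) (auto simp: top.not_eq_extremum)
      finally show "emeasure (L n \<omega>) (space (L n \<omega>)) \<le> 1"
        using \<open>space (L n \<omega>) = UNIV\<close> by simp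
    qed
  next
    fix B :: "'x set" assume B[measurable]: "B \<in> sets borel"
    have "(\<lambda>\<omega>. emeasure (m \<omega>) (D n \<inter> B) / c n \<omega>) \<in> borel_measurable P" by measurable
    then show "(\<lambda>\<omega>. emeasure (L n \<omega>) B) \<in> borel_measurable P"
      by (rule measurable_cong[THEN iffD1, rotated]) (simp add: eL B)
  qed
  have fw: "f \<omega> \<in> borel_measurable borel" if "\<omega> \<in> space P" for \<omega>
    using measurable_Pair2[OF f that] by simp
  have "(\<integral>\<^sup>+x. f \<omega> x \<partial>m \<omega>) = (\<Sum>n. c n \<omega> * (\<integral>\<^sup>+x. f \<omega> x \<partial>L n \<omega>))" if w: "\<omega> \<in> space P" for \<omega>
  proof -
    have "c n \<omega> * (\<integral>\<^sup>+x. f \<omega> x \<partial>L n \<omega>) = (\<integral>\<^sup>+x\<in>D n. f \<omega> x \<partial>m \<omega>)" for n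
    proof -
      have "(\<integral>\<^sup>+x. f \<omega> x \<partial>L n \<omega>) = (\<integral>\<^sup>+x. indicator (D n) x / c n \<omega> * f \<omega> x \<partial>m \<omega>)"
        unfolding L_def by (intro nn_integral_density meas[OF w] fw[OF w]) auto
      also have "c n \<omega> * \<dots> = (\<integral>\<^sup>+x. c n \<omega> * (indicator (D n) x / c n \<omega> * f \<omega> x) \<partial>m \<omega>)"
        using fw[OF w] by (intro nn_integral_cmult[symmetric] meas[OF w]) auto
      also have "\<dots> = (\<integral>\<^sup>+x\<in>D n. f \<omega> x \<partial>m \<omega>)"
      proof (intro nn_integral_cong)
        fix x
        have "c n \<omega> * (1 / c n \<omega>) = 1"
          using c0 cfin[OF w] by (simp add: ennreal_times_divide ennreal_divide_self top.not_eq_extremum)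
        then show "c n \<omega> * (indicator (D n) x / c n \<omega> * f \<omega> x) = f \<omega> x * indicator (D n) x"
          by (auto simp: mult.assoc[symmetric] split: split_indicator)
      qed
      finally show ?thesis .
    qed
    moreover have "(\<Sum>n. \<integral>\<^sup>+x\<in>D n. f \<omega> x \<partial>m \<omega>) = (\<integral>\<^sup>+x\<in>(\<Union>n. D n). f \<omega> x \<partial>m \<omega>)"
      by (intro nn_integral_disjoint_family[symmetric] meas[OF w] fw[OF w] D(1))
         (simp add: sm[OF w])
    ultimately show ?thesis by (simp add: D(2))
  qed
  moreover have "(\<lambda>\<omega>. \<Sum>n. c n \<omega> * (\<integral>\<^sup>+x. f \<omega> x \<partial>L n \<omega>)) \<in> borel_measurable P"
    by (intro borel_measurable_suminf_order borel_measurable_times_ennreal c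
        nn_integral_measurable_subprob_algebra2[OF f L])
  ultimately show ?thesis by (simp cong: measurable_cong)
qed

lemma emeasure_palm_measure:
  fixes m :: "'w \<Rightarrow> 'x::{topological_group_add, second_countable_topology, t2_space} measure"
  assumes lc: "locally_compact_space (euclidean :: 'x topology)"
    and \<theta>: "stationary_framework P \<theta>"
    and m: "simple_point_process P m"
    and w[measurable]: "w \<in> borel_measurable borel"
    and A: "A \<in> sets P"
  shows "emeasure (palm_measure P \<theta> m \<gamma> w) A =
    (\<integral>\<^sup>+\<omega>. (\<integral>\<^sup>+x. indicator A (\<theta> (- x) \<omega>) * ennreal (w x) \<partial>m \<omega>) \<partial>P) / \<gamma>"
proof -
  have sm: "sets (m \<omega>) = sets borel" if "\<omega> \<in> space P" for \<omega>
    using m that by (simp add: simple_point_process_def simple_counting_measure_def)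
  have th: "(\<lambda>(x, \<omega>). \<theta> x \<omega>) \<in> borel \<Otimes>\<^sub>M P \<rightarrow>\<^sub>M P"
    using \<theta> by (simp add: stationary_framework_def)
  have um[measurable]: "uminus \<in> borel_measurable (borel :: 'x measure)"
    by (intro borel_measurable_continuous_onI continuous_intros)
  have shift[measurable]: "(\<lambda>z. \<theta> (- snd z) (fst z)) \<in> P \<Otimes>\<^sub>M borel \<rightarrow>\<^sub>M P"
    using measurable_compose[OF _ th, of "\<lambda>z. (- snd z, fst z)" "P \<Otimes>\<^sub>M borel"] by simp
  let ?g = "\<lambda>A \<omega> x. indicator A (\<theta> (- x) \<omega>) * ennreal (w x)"
  have g: "(\<lambda>(\<omega>, x). ?g A \<omega> x) \<in> borel_measurable (P \<Otimes>\<^sub>M borel)" if [measurable]: "A \<in> sets P" for A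
    unfolding split_beta by measurable
  have gm: "?g A \<omega> \<in> borel_measurable (m \<omega>)" if "A \<in> sets P" "\<omega> \<in> space P" for A \<omega>
    using measurable_Pair2[OF g[OF that(1)] that(2)]
    by (simp add: measurable_cong_sets[OF sm[OF that(2)] refl])
  let ?\<mu> = "\<lambda>A. (\<integral>\<^sup>+\<omega>. (\<integral>\<^sup>+x. ?g A \<omega> x \<partial>m \<omega>) \<partial>P) / \<gamma>"
  have "countably_additive (sets P) ?\<mu>"
  proof (rule countably_additiveI)
    fix F :: "nat \<Rightarrow> 'w set"
    assume F: "range F \<subseteq> sets P" "disjoint_family F"
    have Fn: "F n \<in> sets P" for n using F(1) by auto
    have "(\<integral>\<^sup>+\<omega>. (\<integral>\<^sup>+x. ?g (\<Union>n. F n) \<omega> x \<partial>m \<omega>) \<partial>P)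
        = (\<integral>\<^sup>+\<omega>. (\<integral>\<^sup>+x. (\<Sum>n. ?g (F n) \<omega> x) \<partial>m \<omega>) \<partial>P)"
      by (simp add: suminf_indicator[OF F(2), symmetric])
    also have "\<dots> = (\<integral>\<^sup>+\<omega>. (\<Sum>n. \<integral>\<^sup>+x. ?g (F n) \<omega> x \<partial>m \<omega>) \<partial>P)"
      by (intro nn_integral_cong nn_integral_suminf gm Fn)
    also have "\<dots> = (\<Sum>n. \<integral>\<^sup>+\<omega>. (\<integral>\<^sup>+x. ?g (F n) \<omega> x \<partial>m \<omega>) \<partial>P)"
      by (intro nn_integral_suminf measurable_nn_integral_simple_point_process[OF lc m] g Fn)
    finally show "(\<Sum>n. ?\<mu> (F n)) = ?\<mu> (\<Union>n. F n)"
      by (simp add: divide_ennreal_def)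
  qed
  moreover have "positive (sets P) ?\<mu>" by (simp add: positive_def)
  ultimately show ?thesis
    unfolding palm_measure_def using A
    by (intro emeasure_measure_of_sigma sets.sigma_algebra_axioms) auto
qed

end

theory Submission
  imports Defs
begin

text \<open>
  Write \<open>E\<close> for the expectation under \<open>P\<close>. In unnormalised form the Palm measure of an event \<open>A\<close> is
  \<open>E (\<Sum>x. 1[\<theta> (- x) \<omega> \<in> A] w(x))\<close>, the sum over the points of \<open>m \<omega>\<close>: the
  configuration is looked at from \<open>x\<close>. Equivariance of \<open>H\<close> turns the Palm measure of
  \<open>{\<theta> (- point_map H \<omega>) \<omega> \<in> A}\<close> into the same expression in which the configuration is looked at
  from \<open>H \<omega> x\<close>, but the weight is still taken at \<open>x\<close>. The heart of the proof is that on a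
  unimodular group the weight may be moved from \<open>x\<close> to \<open>H \<omega> x\<close> (\<open>mass_transport\<close>,
  \<open>weight_normalisation\<close>). After that the sum depends on \<open>x\<close> only through \<open>y = H \<omega> x\<close>, and
  collecting the points with the same image gives
  \<open>E (\<Sum>y. 1[\<theta> (- y) \<omega> \<in> A] N(y) w(y))\<close>, where \<open>N(y)\<close> is the number of points that \<open>H\<close> sends
  to \<open>y\<close> (\<open>palm_measure_shifted\<close>).

  So the point-shift multiplies the Palm measure by the density \<open>N(0)\<close>, and it preserves
  the Palm measure exactly when \<open>N(0) = 1\<close> almost surely under the Palm measure. A property of the points that is
  compatible with the action and holds at the Palm-typical point holds at all points almost surely
  (\<open>AE_atoms_eq_0\<close>), so that this means \<open>N(y) = 1\<close> for all points \<open>y\<close> almost surely, which is bijectivity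
  (\<open>bijective_iff_in_degree\<close>).
\<close>

section \<open>Borel measures on the group\<close>

lemma borel_measurable_uminus_group [measurable]:
  "(uminus :: 'x::topological_group_add \<Rightarrow> 'x) \<in> borel_measurable borel"
  by (intro borel_measurable_continuous_onI continuous_intros)

lemma sigma_finite_if_finite_on_compact:
  fixes \<mu> :: "'x::{second_countable_topology, t2_space} measure"
  assumes "locally_compact_space (euclidean :: 'x topology)"
    and s: "sets \<mu> = sets borel" and fin: "\<And>K. compact K \<Longrightarrow> emeasure \<mu> K < \<infinity>"
  shows "sigma_finite_measure \<mu>"
proof
  obtain D :: "nat \<Rightarrow> 'x set" where D: "(\<Union>n. D n) = UNIV"
      "\<And>n. D n \<in> sets borel" "\<And>n. \<exists>K. compact K \<and> D n \<subseteq> K"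
    using countable_disjoint_relatively_compact_cover[OF assms(1)] by metis
  have "emeasure \<mu> (D n) \<noteq> \<infinity>" for n
  proof -
    obtain K where K: "compact K" "D n \<subseteq> K" using D(3) by blast
    then have "emeasure \<mu> (D n) \<le> emeasure \<mu> K"
      by (intro emeasure_mono) (simp_all add: s borel_closed compact_imp_closed)
    then show ?thesis using fin[OF K(1)] by (auto simp: top_unique)
  qed
  then show "\<exists>A. countable A \<and> A \<subseteq> sets \<mu> \<and> \<Union>A = space \<mu> \<and> (\<forall>a\<in>A. emeasure \<mu> a \<noteq> \<infinity>)"
    using D(1,2) sets_eq_imp_space_eq[OF s]
    by (intro exI[of _ "range D"] conjI) (simp_all add: s image_subset_iff)
qed

lemma simple_counting_measure_eq_distr_count_space:
  assumes "simple_counting_measure (\<mu> :: 'x::t2_space measure)"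
  shows "\<mu> = distr (count_space (atoms \<mu>)) borel (\<lambda>x. x)"
proof -
  have s: "sets \<mu> = sets borel"
    using assms by (simp add: simple_counting_measure_def)
  have "\<exists>S. \<forall>B\<in>sets borel. emeasure \<mu> B = emeasure (count_space UNIV) (S \<inter> B)"
    using assms by (simp only: simple_counting_measure_def)
  then obtain S where "\<forall>B\<in>sets borel. emeasure \<mu> B = emeasure (count_space UNIV) (S \<inter> B)" ..
  then have S: "emeasure \<mu> B = emeasure (count_space UNIV) (S \<inter> B)" if "B \<in> sets borel" for B
    using that by (rule bspec)
  have "emeasure \<mu> {x} \<noteq> 0 \<longleftrightarrow> x \<in> S" for x
    using S[of "{x}"] by (cases "x \<in> S") auto
  then have at: "atoms \<mu> = S" by (auto simp: atoms_def)
  show ?thesis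
  proof (rule measure_eqI)
    fix B assume "B \<in> sets \<mu>"
    then have B: "B \<in> sets borel" by (simp add: s)
    have "emeasure (count_space UNIV) (S \<inter> B) = emeasure (count_space S) (S \<inter> B)"
      by (cases "finite (S \<inter> B)") (simp_all add: emeasure_count_space_finite emeasure_count_space_infinite)
    then show "emeasure \<mu> B = emeasure (distr (count_space (atoms \<mu>)) borel (\<lambda>x. x)) B"
      using B by (subst emeasure_distr) (auto simp: S at Int_commute)
  qed (simp add: s)
qed

lemma nn_integral_simple_counting_measure:
  fixes \<mu> :: "'x::t2_space measure"
  assumes "simple_counting_measure \<mu>" and [measurable]: "f \<in> borel_measurable borel"
  shows "(\<integral>\<^sup>+x. f x \<partial>\<mu>) = (\<integral>\<^sup>+x. f x \<partial>count_space (atoms \<mu>))"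
  by (subst simple_counting_measure_eq_distr_count_space[OF assms(1)]) (simp add: nn_integral_distr)

section \<open>Stationary point processes on a unimodular group\<close>

locale unimodular_point_process =
  fixes \<nu> :: "'x::{topological_group_add, second_countable_topology, t2_space} measure"
    and P :: "'w measure"
    and \<theta> :: "'x \<Rightarrow> 'w \<Rightarrow> 'w"
    and m :: "'w \<Rightarrow> 'x measure"
  assumes locally_compact: "locally_compact_space (euclidean :: 'x topology)"
    and haar: "left_haar_measure \<nu>"
    and right_invariant: "right_invariant \<nu>"
    and stationary: "stationary_framework P \<theta>"
    and simple: "simple_point_process P m"
    and adapted: "flow_adapted P \<theta> m"
begin

lemma sets_haar [measurable_cong, simp]: "sets \<nu> = sets borel"
  using haar by (simp add: left_haar_measure_def)

lemma sigma_finite_haar: "sigma_finite_measure \<nu>"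
  using haar by (intro sigma_finite_if_finite_on_compact locally_compact) (simp_all add: left_haar_measure_def)

lemma prob_space_P: "prob_space P"
  using stationary by (simp add: stationary_framework_def)

lemma sets_process: "\<omega> \<in> space P \<Longrightarrow> sets (m \<omega>) = sets borel"
  using simple by (simp add: simple_point_process_def simple_counting_measure_def)

lemma simple_counting: "\<omega> \<in> space P \<Longrightarrow> simple_counting_measure (m \<omega>)"
  using simple by (simp add: simple_point_process_def)

lemma sigma_finite_process: "\<omega> \<in> space P \<Longrightarrow> sigma_finite_measure (m \<omega>)"
  using simple_counting
  by (intro sigma_finite_if_finite_on_compact locally_compact) (simp_all add: simple_counting_measure_def)

lemma borel_measurable_process:
  "\<omega> \<in> space P \<Longrightarrow> f \<in> borel_measurable borel \<Longrightarrow> f \<in> borel_measurable (m \<omega>)"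
  by (simp add: measurable_cong_sets[OF sets_process refl])

lemma measurable_action [measurable (raw)]:
  assumes "f \<in> N \<rightarrow>\<^sub>M borel" "g \<in> N \<rightarrow>\<^sub>M P"
  shows "(\<lambda>n. \<theta> (f n) (g n)) \<in> N \<rightarrow>\<^sub>M P"
  using measurable_compose[OF measurable_Pair[OF assms], of "\<lambda>(x, \<omega>). \<theta> x \<omega>"] stationary
  by (simp add: stationary_framework_def)

lemma action_in_space: "\<omega> \<in> space P \<Longrightarrow> \<theta> x \<omega> \<in> space P"
  using measurable_space[of "\<theta> x" P P \<omega>] by simp

lemma action_add: "\<omega> \<in> space P \<Longrightarrow> \<theta> x (\<theta> y \<omega>) = \<theta> (x + y) \<omega>"
  using stationary by (simp add: stationary_framework_def)

lemma nn_integral_haar_left: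
  assumes [measurable]: "f \<in> borel_measurable borel"
  shows "(\<integral>\<^sup>+z. f (x + z) \<partial>\<nu>) = (\<integral>\<^sup>+z. f z \<partial>\<nu>)"
proof -
  have "distr \<nu> borel ((+) x) = \<nu>"
  proof (rule measure_eqI)
    fix B assume "B \<in> sets (distr \<nu> borel ((+) x))"
    then have B: "B \<in> sets borel" by simp
    have "(+) x -` B \<inter> space \<nu> = (\<lambda>y. - x + y) ` B"
      using sets_eq_imp_space_eq[OF sets_haar]
      by (auto simp: add.assoc[symmetric] image_iff intro!: bexI[of _ "x + _"])
    then show "emeasure (distr \<nu> borel ((+) x)) B = emeasure \<nu> B"
      using haar B by (simp add: emeasure_distr left_haar_measure_def)
  qed simp
  then show ?thesis
    using nn_integral_distr[of "(+) x" \<nu> borel f] by simp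
qed

lemma nn_integral_haar_right:
  assumes [measurable]: "f \<in> borel_measurable borel"
  shows "(\<integral>\<^sup>+z. f (z + x) \<partial>\<nu>) = (\<integral>\<^sup>+z. f z \<partial>\<nu>)"
proof -
  have "distr \<nu> borel (\<lambda>z. z + x) = \<nu>"
  proof (rule measure_eqI)
    fix B assume "B \<in> sets (distr \<nu> borel (\<lambda>z. z + x))"
    then have B: "B \<in> sets borel" by simp
    have "(\<lambda>z. z + x) -` B \<inter> space \<nu> = (\<lambda>y. y + - x) ` B"
      using sets_eq_imp_space_eq[OF sets_haar]
      by (auto simp: add.assoc image_iff intro!: bexI[of _ "_ + x"])
    then show "emeasure (distr \<nu> borel (\<lambda>z. z + x)) B = emeasure \<nu> B"
      using right_invariant B
      by (simp add: emeasure_distr right_invariant_def del: add_uminus_conv_diff)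
  qed simp
  then show ?thesis
    using nn_integral_distr[of "\<lambda>z. z + x" \<nu> borel f] by simp
qed

lemma nn_integral_process_action:
  assumes \<omega>: "\<omega> \<in> space P" and [measurable]: "f \<in> borel_measurable borel"
  shows "(\<integral>\<^sup>+x. f x \<partial>m (\<theta> z \<omega>)) = (\<integral>\<^sup>+x. f (z + x) \<partial>m \<omega>)"
proof -
  note [measurable_cong] = sets_process[OF \<omega>]
  have "m (\<theta> z \<omega>) = distr (m \<omega>) borel ((+) z)"
  proof (rule measure_eqI)
    fix B assume "B \<in> sets (m (\<theta> z \<omega>))"
    then have B: "B \<in> sets borel" using sets_process[OF action_in_space[OF \<omega>]] by simp
    have "(+) z -` B \<inter> space (m \<omega>) = (\<lambda>y. - z + y) ` B"
      using sets_eq_imp_space_eq[OF sets_process[OF \<omega>]]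
      by (auto simp: add.assoc[symmetric] image_iff intro!: bexI[of _ "z + _"])
    then show "emeasure (m (\<theta> z \<omega>)) B = emeasure (distr (m \<omega>) borel ((+) z)) B"
      using adapted B \<omega> by (simp add: emeasure_distr flow_adapted_def)
  qed (simp add: sets_process action_in_space \<omega>)
  then show ?thesis by (simp add: nn_integral_distr)
qed

text \<open>
  The configuration depends on the parameter through \<open>g\<close>, which covers integrands with further
  variables, such as a group element \<open>z\<close> or the target point of the point-shift: take for \<open>g\<close> the
  projection to \<open>P\<close>.
\<close>

lemma measurable_nn_integral_process [measurable (raw)]:
  assumes [measurable]: "(\<lambda>(n, x). f n x) \<in> borel_measurable (N \<Otimes>\<^sub>M borel)" and g: "g \<in> N \<rightarrow>\<^sub>M P"
  shows "(\<lambda>n. \<integral>\<^sup>+x. f n x \<partial>m (g n)) \<in> borel_measurable N"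
proof (rule measurable_nn_integral_simple_point_process[OF locally_compact _ assms(1)])
  show "simple_point_process N (\<lambda>n. m (g n))"
    using simple measurable_space[OF g] unfolding simple_point_process_def
    by (auto intro: measurable_compose[OF g])
qed

lemma campbell_action:
  assumes [measurable]: "(\<lambda>(\<omega>, x). f \<omega> x) \<in> borel_measurable (P \<Otimes>\<^sub>M borel)"
  shows "(\<integral>\<^sup>+\<omega>. \<integral>\<^sup>+x. f \<omega> x \<partial>m \<omega> \<partial>P) = (\<integral>\<^sup>+\<omega>. \<integral>\<^sup>+x. f (\<theta> z \<omega>) (z + x) \<partial>m \<omega> \<partial>P)"
proof -
  have "(\<integral>\<^sup>+\<omega>. \<integral>\<^sup>+x. f \<omega> x \<partial>m \<omega> \<partial>P) = (\<integral>\<^sup>+\<omega>. \<integral>\<^sup>+x. f \<omega> x \<partial>m \<omega> \<partial>distr P P (\<theta> z))"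
    using stationary by (simp add: stationary_framework_def)
  also have "\<dots> = (\<integral>\<^sup>+\<omega>. \<integral>\<^sup>+x. f (\<theta> z \<omega>) x \<partial>m (\<theta> z \<omega>) \<partial>P)"
    by (intro nn_integral_distr) measurable
  also have "\<dots> = (\<integral>\<^sup>+\<omega>. \<integral>\<^sup>+x. f (\<theta> z \<omega>) (z + x) \<partial>m \<omega> \<partial>P)"
    using measurable_Pair2[OF assms action_in_space]
    by (intro nn_integral_cong nn_integral_process_action) simp_all
  finally show ?thesis .
qed

lemma haar_campbell_swap:
  assumes f: "(\<lambda>(z, \<omega>, x). f z \<omega> x) \<in> borel_measurable (borel \<Otimes>\<^sub>M (P \<Otimes>\<^sub>M borel))"
  shows "(\<integral>\<^sup>+z. \<integral>\<^sup>+\<omega>. \<integral>\<^sup>+x. f z \<omega> x \<partial>m \<omega> \<partial>P \<partial>\<nu>) = (\<integral>\<^sup>+\<omega>. \<integral>\<^sup>+x. \<integral>\<^sup>+z. f z \<omega> x \<partial>\<nu> \<partial>m \<omega> \<partial>P)"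
proof -
  interpret \<nu>: sigma_finite_measure \<nu> by (rule sigma_finite_haar)
  interpret P: prob_space P by (rule prob_space_P)
  interpret P\<nu>: pair_sigma_finite P \<nu> ..
  have [measurable (raw)]: "(\<lambda>n. f (z n) (\<omega> n) (x n)) \<in> borel_measurable N"
    if "z \<in> N \<rightarrow>\<^sub>M borel" "\<omega> \<in> N \<rightarrow>\<^sub>M P" "x \<in> N \<rightarrow>\<^sub>M borel" for z \<omega> x N
    using measurable_compose[OF measurable_Pair[OF that(1) measurable_Pair[OF that(2,3)]] f] by simp
  have "(\<integral>\<^sup>+z. \<integral>\<^sup>+\<omega>. \<integral>\<^sup>+x. f z \<omega> x \<partial>m \<omega> \<partial>P \<partial>\<nu>) = (\<integral>\<^sup>+\<omega>. \<integral>\<^sup>+z. \<integral>\<^sup>+x. f z \<omega> x \<partial>m \<omega> \<partial>\<nu> \<partial>P)"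
    by (rule P\<nu>.Fubini') measurable
  also have "\<dots> = (\<integral>\<^sup>+\<omega>. \<integral>\<^sup>+x. \<integral>\<^sup>+z. f z \<omega> x \<partial>\<nu> \<partial>m \<omega> \<partial>P)"
  proof (rule nn_integral_cong)
    fix \<omega> assume \<omega> [measurable]: "\<omega> \<in> space P"
    note [measurable_cong] = sets_process[OF \<omega>]
    interpret m: sigma_finite_measure "m \<omega>" by (rule sigma_finite_process[OF \<omega>])
    interpret m\<nu>: pair_sigma_finite "m \<omega>" \<nu> ..
    show "(\<integral>\<^sup>+z. \<integral>\<^sup>+x. f z \<omega> x \<partial>m \<omega> \<partial>\<nu>) = (\<integral>\<^sup>+x. \<integral>\<^sup>+z. f z \<omega> x \<partial>\<nu> \<partial>m \<omega>)"
      by (rule m\<nu>.Fubini') measurable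
  qed
  finally show ?thesis .
qed

text \<open>
  Multiply the summand \<open>a \<omega> x * f x\<close> by \<open>\<integral>g(z + Y \<omega> x) dz\<close>, which is \<open>\<integral>g\<close> by right
  invariance, whatever the random point \<open>Y \<omega> x\<close> is. For each fixed \<open>z\<close>, stationarity lets the whole
  picture be moved by \<open>- z\<close>; this replaces \<open>f x * g (z + Y \<omega> x)\<close> by
  \<open>f (- z + x) * g (Y \<omega> x)\<close>, and now the integral over \<open>z\<close> falls on \<open>f\<close>, where left invariance gives
  \<open>\<integral>f(- z) dz\<close>.

  With \<open>Y\<close> a point-shift this moves a weight from a point to its image; with \<open>Y \<omega> x = x\<close> it compares
  two weight functions.
\<close>

lemma mass_transport:
  fixes a :: "'w \<Rightarrow> 'x \<Rightarrow> ennreal" and Y :: "'w \<Rightarrow> 'x \<Rightarrow> 'x"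
  assumes a [measurable]: "(\<lambda>(\<omega>, x). a \<omega> x) \<in> borel_measurable (P \<Otimes>\<^sub>M borel)"
    and Y [measurable]: "(\<lambda>(\<omega>, x). Y \<omega> x) \<in> P \<Otimes>\<^sub>M borel \<rightarrow>\<^sub>M borel"
    and f [measurable]: "f \<in> borel_measurable borel" and g [measurable]: "g \<in> borel_measurable borel"
    and a_inv: "\<And>\<omega> z x. \<omega> \<in> space P \<Longrightarrow> a (\<theta> z \<omega>) (z + x) = a \<omega> x"
    and Y_equiv: "\<And>\<omega> z x. \<omega> \<in> space P \<Longrightarrow> Y (\<theta> z \<omega>) (z + x) = z + Y \<omega> x"
  shows "(\<integral>\<^sup>+z. g z \<partial>\<nu>) * (\<integral>\<^sup>+\<omega>. \<integral>\<^sup>+x. a \<omega> x * f x \<partial>m \<omega> \<partial>P)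
       = (\<integral>\<^sup>+z. f (- z) \<partial>\<nu>) * (\<integral>\<^sup>+\<omega>. \<integral>\<^sup>+x. a \<omega> x * g (Y \<omega> x) \<partial>m \<omega> \<partial>P)"
proof -
  have scale: "(\<integral>\<^sup>+\<omega>. \<integral>\<^sup>+x. c * h \<omega> x \<partial>m \<omega> \<partial>P) = c * (\<integral>\<^sup>+\<omega>. \<integral>\<^sup>+x. h \<omega> x \<partial>m \<omega> \<partial>P)"
    if [measurable]: "(\<lambda>(\<omega>, x). h \<omega> x) \<in> borel_measurable (P \<Otimes>\<^sub>M borel)" for c :: ennreal and h
  proof -
    have "(\<integral>\<^sup>+\<omega>. \<integral>\<^sup>+x. c * h \<omega> x \<partial>m \<omega> \<partial>P) = (\<integral>\<^sup>+\<omega>. c * \<integral>\<^sup>+x. h \<omega> x \<partial>m \<omega> \<partial>P)"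
      using measurable_Pair2[OF that]
      by (intro nn_integral_cong nn_integral_cmult borel_measurable_process) simp_all
    also have "\<dots> = c * (\<integral>\<^sup>+\<omega>. \<integral>\<^sup>+x. h \<omega> x \<partial>m \<omega> \<partial>P)"
      by (intro nn_integral_cmult) measurable
    finally show ?thesis .
  qed
  have "(\<integral>\<^sup>+z. g z \<partial>\<nu>) * (\<integral>\<^sup>+\<omega>. \<integral>\<^sup>+x. a \<omega> x * f x \<partial>m \<omega> \<partial>P)
      = (\<integral>\<^sup>+\<omega>. \<integral>\<^sup>+x. (\<integral>\<^sup>+z. g z \<partial>\<nu>) * (a \<omega> x * f x) \<partial>m \<omega> \<partial>P)"
    by (rule scale[symmetric]) measurable
  also have "\<dots> = (\<integral>\<^sup>+\<omega>. \<integral>\<^sup>+x. \<integral>\<^sup>+z. a \<omega> x * f x * g (z + Y \<omega> x) \<partial>\<nu> \<partial>m \<omega> \<partial>P)"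
    by (simp add: nn_integral_cmult nn_integral_haar_right mult.commute)
  also have "\<dots> = (\<integral>\<^sup>+z. \<integral>\<^sup>+\<omega>. \<integral>\<^sup>+x. a \<omega> x * f x * g (z + Y \<omega> x) \<partial>m \<omega> \<partial>P \<partial>\<nu>)"
    by (rule haar_campbell_swap[symmetric]) measurable
  also have "\<dots> = (\<integral>\<^sup>+z. \<integral>\<^sup>+\<omega>. \<integral>\<^sup>+x. a \<omega> x * f (- z + x) * g (Y \<omega> x) \<partial>m \<omega> \<partial>P \<partial>\<nu>)"
  proof (rule nn_integral_cong)
    fix z
    have "(\<integral>\<^sup>+\<omega>. \<integral>\<^sup>+x. a \<omega> x * f x * g (z + Y \<omega> x) \<partial>m \<omega> \<partial>P)
      = (\<integral>\<^sup>+\<omega>. \<integral>\<^sup>+x. a (\<theta> (- z) \<omega>) (- z + x) * f (- z + x) * g (z + Y (\<theta> (- z) \<omega>) (- z + x)) \<partial>m \<omega> \<partial>P)"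
      by (rule campbell_action) measurable
    also have "\<dots> = (\<integral>\<^sup>+\<omega>. \<integral>\<^sup>+x. a \<omega> x * f (- z + x) * g (Y \<omega> x) \<partial>m \<omega> \<partial>P)"
      by (intro nn_integral_cong) (simp only: a_inv Y_equiv add.assoc[symmetric] add.right_inverse add.left_neutral)
    finally show "(\<integral>\<^sup>+\<omega>. \<integral>\<^sup>+x. a \<omega> x * f x * g (z + Y \<omega> x) \<partial>m \<omega> \<partial>P)
      = (\<integral>\<^sup>+\<omega>. \<integral>\<^sup>+x. a \<omega> x * f (- z + x) * g (Y \<omega> x) \<partial>m \<omega> \<partial>P)" .
  qed
  also have "\<dots> = (\<integral>\<^sup>+\<omega>. \<integral>\<^sup>+x. \<integral>\<^sup>+z. a \<omega> x * f (- z + x) * g (Y \<omega> x) \<partial>\<nu> \<partial>m \<omega> \<partial>P)"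
    by (rule haar_campbell_swap) measurable
  also have "\<dots> = (\<integral>\<^sup>+\<omega>. \<integral>\<^sup>+x. (\<integral>\<^sup>+z. f (- z) \<partial>\<nu>) * (a \<omega> x * g (Y \<omega> x)) \<partial>m \<omega> \<partial>P)"
  proof (intro nn_integral_cong)
    fix \<omega> x
    \<comment> \<open>Substitute \<open>x + z\<close> for \<open>z\<close>; then \<open>- (x + z) + x = - z\<close>.\<close>
    have "(\<integral>\<^sup>+z. f (- z + x) \<partial>\<nu>) = (\<integral>\<^sup>+z. f (- (x + z) + x) \<partial>\<nu>)"
      by (rule nn_integral_haar_left[symmetric]) measurable
    also have "\<dots> = (\<integral>\<^sup>+z. f (- z) \<partial>\<nu>)"
      by (simp add: minus_add add.assoc)
    finally show "(\<integral>\<^sup>+z. a \<omega> x * f (- z + x) * g (Y \<omega> x) \<partial>\<nu>) = (\<integral>\<^sup>+z. f (- z) \<partial>\<nu>) * (a \<omega> x * g (Y \<omega> x))"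
      by (simp add: nn_integral_cmult nn_integral_multc mult_ac)
  qed
  also have "\<dots> = (\<integral>\<^sup>+z. f (- z) \<partial>\<nu>) * (\<integral>\<^sup>+\<omega>. \<integral>\<^sup>+x. a \<omega> x * g (Y \<omega> x) \<partial>m \<omega> \<partial>P)"
    by (rule scale) measurable
  finally show ?thesis .
qed

text \<open>
  An invariant \<open>a\<close> cannot be detected by one weight of positive integral and missed by another. By
  \<open>mass_transport\<close> with \<open>Y \<omega> x = x\<close>, a vanishing expectation for \<open>w\<close> forces the one for the
  constant weight \<open>1\<close> to vanish, even if the Haar measure is infinite, because \<open>\<infinity> * 0 = 0\<close>.
\<close>

lemma AE_atoms_eq_0:
  fixes a :: "'w \<Rightarrow> 'x \<Rightarrow> ennreal"
  assumes a [measurable]: "(\<lambda>(\<omega>, x). a \<omega> x) \<in> borel_measurable (P \<Otimes>\<^sub>M borel)"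
    and a_inv: "\<And>\<omega> z x. \<omega> \<in> space P \<Longrightarrow> a (\<theta> z \<omega>) (z + x) = a \<omega> x"
    and w [measurable]: "w \<in> borel_measurable borel" and w_pos: "(\<integral>\<^sup>+z. w z \<partial>\<nu>) \<noteq> 0"
    and null: "(\<integral>\<^sup>+\<omega>. \<integral>\<^sup>+x. a \<omega> x * w x \<partial>m \<omega> \<partial>P) = 0"
  shows "AE \<omega> in P. \<forall>x\<in>atoms (m \<omega>). a \<omega> x = 0"
proof -
  have "(\<integral>\<^sup>+z. w z \<partial>\<nu>) * (\<integral>\<^sup>+\<omega>. \<integral>\<^sup>+x. a \<omega> x * 1 \<partial>m \<omega> \<partial>P) = 0"
    using mass_transport[OF a _ _ w a_inv, of "\<lambda>\<omega> x. x" "\<lambda>x. 1"] null by simp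
  then have "(\<integral>\<^sup>+\<omega>. \<integral>\<^sup>+x. a \<omega> x \<partial>m \<omega> \<partial>P) = 0"
    using w_pos by simp
  then have "AE \<omega> in P. (\<integral>\<^sup>+x. a \<omega> x \<partial>m \<omega>) = 0"
    by (subst (asm) nn_integral_0_iff_AE) measurable
  then show ?thesis
    using AE_space
  proof eventually_elim
    fix \<omega> assume 0: "(\<integral>\<^sup>+x. a \<omega> x \<partial>m \<omega>) = 0" and \<omega>: "\<omega> \<in> space P"
    have "(\<integral>\<^sup>+x. a \<omega> x \<partial>count_space (atoms (m \<omega>))) = 0"
      using nn_integral_simple_counting_measure[OF simple_counting[OF \<omega>], of "a \<omega>"] 0
        measurable_Pair2[OF a \<omega>] by simp
    then show "\<forall>x\<in>atoms (m \<omega>). a \<omega> x = 0"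
      by (simp add: nn_integral_0_iff_AE AE_count_space)
  qed
qed

text \<open>
  On a unimodular group the Haar measure is invariant under \<open>z \<mapsto> - z\<close>. What is needed of this
  follows from the existence of a point process of positive finite intensity: with the
  constant \<open>a = 1\<close> and \<open>Y \<omega> x = x\<close>, \<open>mass_transport\<close> relates the sums of any two weights over the
  points, and comparing \<open>B\<close> with itself, \<open>B\<close> with \<open>w\<close>, and \<open>w\<close> with \<open>B\<close> pins down the
  reflected integrals and the expected sum of \<open>w\<close>.
\<close>

lemma weight_normalisation:
  fixes w :: "'x \<Rightarrow> ennreal"
  assumes B [measurable]: "B \<in> sets borel" and B_pos: "0 < emeasure \<nu> B" "emeasure \<nu> B < \<infinity>"
    and int: "0 < intensity P m \<nu> B" "intensity P m \<nu> B < \<infinity>"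
    and w [measurable]: "w \<in> borel_measurable borel" and w_1: "(\<integral>\<^sup>+z. w z \<partial>\<nu>) = 1"
  shows "(\<integral>\<^sup>+z. w (- z) \<partial>\<nu>) = 1"
    and "(\<integral>\<^sup>+\<omega>. \<integral>\<^sup>+x. w x \<partial>m \<omega> \<partial>P) < \<infinity>"
proof -
  define E where "E f = (\<integral>\<^sup>+\<omega>. \<integral>\<^sup>+x. f x \<partial>m \<omega> \<partial>P)" for f :: "'x \<Rightarrow> ennreal"
  have exchange: "(\<integral>\<^sup>+z. g z \<partial>\<nu>) * E f = (\<integral>\<^sup>+z. f (- z) \<partial>\<nu>) * E g"
    if "f \<in> borel_measurable borel" "g \<in> borel_measurable borel" for f g
    using mass_transport[of "\<lambda>\<omega> x. 1" "\<lambda>\<omega> x. x" f g] that by (simp add: E_def)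
  have EB: "E (indicator B) = (\<integral>\<^sup>+\<omega>. emeasure (m \<omega>) B \<partial>P)"
    unfolding E_def by (intro nn_integral_cong) (simp add: sets_process)
  have EB_fin: "E (indicator B) \<noteq> \<top>" and EB_pos: "E (indicator B) \<noteq> 0"
    using int B_pos by (auto simp: EB intensity_def ennreal_top_divide split: if_splits)
  have cancel: "x = y" if "x * E (indicator B) = y * E (indicator B)" for x y
    using that EB_fin EB_pos
    by (simp add: mult.commute[of _ "E (indicator B)"] ennreal_mult_cancel_left)
  have \<nu>B: "(\<integral>\<^sup>+z. indicator B z \<partial>\<nu>) = emeasure \<nu> B"
    by simp
  have refl: "(\<integral>\<^sup>+z. indicator B (- z) \<partial>\<nu>) = emeasure \<nu> B"
    using exchange[of "indicator B" "indicator B"] \<nu>B by - (rule cancel, simp)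
  have Ew: "E (indicator B) = emeasure \<nu> B * E w"
    using exchange[of "indicator B" w] w_1 refl by simp
  have "emeasure \<nu> B * E w = (\<integral>\<^sup>+z. w (- z) \<partial>\<nu>) * E (indicator B)"
    using exchange[of w "indicator B"] \<nu>B by simp
  then show "(\<integral>\<^sup>+z. w (- z) \<partial>\<nu>) = 1"
    using Ew by - (rule cancel, simp)
  have "E w \<noteq> \<top>"
    using Ew EB_fin B_pos by (auto simp: ennreal_mult_top split: if_splits)
  then show "(\<integral>\<^sup>+\<omega>. \<integral>\<^sup>+x. w x \<partial>m \<omega> \<partial>P) < \<infinity>"
    by (simp add: E_def top.not_eq_extremum)
qed

end

section \<open>Point-shifts\<close>

lemma bij_betw_iff_ex1_preimage:
  assumes into: "\<forall>x\<in>A. f x \<in> C"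
  shows "bij_betw f A C \<longleftrightarrow> (\<forall>y\<in>C. \<exists>!x. x \<in> A \<and> f x = y)"
proof
  assume "bij_betw f A C"
  then have "inj_on f A" "f ` A = C" by (simp_all add: bij_betw_def)
  then show "\<forall>y\<in>C. \<exists>!x. x \<in> A \<and> f x = y" by (auto dest: inj_onD)
next
  assume *: "\<forall>y\<in>C. \<exists>!x. x \<in> A \<and> f x = y"
  have "inj_on f A" using * into by (intro inj_onI) metis
  moreover have "f ` A = C" using * into by blast
  ultimately show "bij_betw f A C" by (simp add: bij_betw_def)
qed

locale unimodular_point_shift = unimodular_point_process \<nu> P \<theta> m
  for \<nu> :: "'x::{topological_group_add, second_countable_topology, t2_space} measure"
    and P :: "'w measure" and \<theta> m +
  fixes H :: "'w \<Rightarrow> 'x \<Rightarrow> 'x"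
  assumes point_shift: "point_shift P \<theta> m H"
begin

lemma measurable_point_shift [measurable]: "(\<lambda>(\<omega>, x). H \<omega> x) \<in> P \<Otimes>\<^sub>M borel \<rightarrow>\<^sub>M borel"
  using point_shift by (simp add: point_shift_def)

lemma AE_point_shift_atoms: "AE \<omega> in P. \<forall>x\<in>atoms (m \<omega>). H \<omega> x \<in> atoms (m \<omega>)"
  using point_shift by (simp add: point_shift_def)

lemma point_shift_action: "\<omega> \<in> space P \<Longrightarrow> H (\<theta> z \<omega>) (z + x) = z + H \<omega> x"
  using point_shift by (simp add: point_shift_def)

definition in_degree :: "'w \<Rightarrow> 'x \<Rightarrow> ennreal" where
  "in_degree \<omega> y = (\<integral>\<^sup>+x. indicator {y} (H \<omega> x) \<partial>m \<omega>)"

lemma borel_measurable_eq_indicator [measurable (raw)]: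
  assumes [measurable]: "f \<in> N \<rightarrow>\<^sub>M borel" "g \<in> N \<rightarrow>\<^sub>M borel"
  shows "(\<lambda>n. indicator {f n} (g n :: 'x) :: ennreal) \<in> borel_measurable N"
  unfolding indicator_def singleton_iff by measurable

lemma measurable_in_degree [measurable]:
  "(\<lambda>(\<omega>, y). in_degree \<omega> y) \<in> borel_measurable (P \<Otimes>\<^sub>M borel)"
  unfolding in_degree_def split_beta by measurable

lemma in_degree_action:
  assumes \<omega> [measurable]: "\<omega> \<in> space P"
  shows "in_degree (\<theta> z \<omega>) (z + y) = in_degree \<omega> y"
proof -
  have [measurable]: "\<theta> z \<omega> \<in> space P" by (rule action_in_space[OF \<omega>])
  have "in_degree (\<theta> z \<omega>) (z + y) = (\<integral>\<^sup>+x. indicator {z + y} (H (\<theta> z \<omega>) (z + x)) \<partial>m \<omega>)"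
    unfolding in_degree_def by (rule nn_integral_process_action[OF \<omega>]) measurable
  also have "\<dots> = in_degree \<omega> y"
    unfolding in_degree_def by (simp add: point_shift_action[OF \<omega>] indicator_def)
  finally show ?thesis .
qed

lemma in_degree_origin: "\<omega> \<in> space P \<Longrightarrow> in_degree (\<theta> (- y) \<omega>) 0 = in_degree \<omega> y"
  using in_degree_action[of \<omega> "- y" y] by simp

lemma in_degree_eq_emeasure:
  assumes \<omega> [measurable]: "\<omega> \<in> space P"
  shows "in_degree \<omega> y = emeasure (count_space (atoms (m \<omega>))) {x \<in> atoms (m \<omega>). H \<omega> x = y}"
proof -
  have "in_degree \<omega> y = (\<integral>\<^sup>+x. indicator {y} (H \<omega> x) \<partial>count_space (atoms (m \<omega>)))"
    unfolding in_degree_def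
    by (rule nn_integral_simple_counting_measure[OF simple_counting[OF \<omega>]]) measurable
  also have "\<dots> = (\<integral>\<^sup>+x. indicator {x \<in> atoms (m \<omega>). H \<omega> x = y} x \<partial>count_space (atoms (m \<omega>)))"
    by (intro nn_integral_cong) (simp split: split_indicator)
  finally show ?thesis by simp
qed

text \<open>
  The gap between 1 and 2 is what lets the events of in-degree 0 and of in-degree at least 2 be
  excluded separately.
\<close>

lemma in_degree_cases:
  assumes "\<omega> \<in> space P"
  obtains "in_degree \<omega> y = 0" | "in_degree \<omega> y = 1" | "2 \<le> in_degree \<omega> y"
proof (cases "finite {x \<in> atoms (m \<omega>). H \<omega> x = y}")
  case True
  define k where "k = card {x \<in> atoms (m \<omega>). H \<omega> x = y}"
  have k: "in_degree \<omega> y = of_nat k"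
    using True by (simp add: in_degree_eq_emeasure[OF assms] emeasure_count_space k_def)
  have "k = 0 \<or> k = 1 \<or> 2 \<le> k" by arith
  moreover have "2 \<le> in_degree \<omega> y" if "2 \<le> k"
    using of_nat_mono[OF that, where ?'a = ennreal] k by simp
  ultimately show ?thesis using that k by auto
next
  case False
  then show ?thesis using that(3) by (simp add: in_degree_eq_emeasure[OF assms] emeasure_count_space)
qed

lemma bijective_iff_in_degree:
  "bijective_point_shift P m H \<longleftrightarrow> (AE \<omega> in P. \<forall>y\<in>atoms (m \<omega>). in_degree \<omega> y = 1)"
proof -
  have pointwise: "bij_betw (H \<omega>) (atoms (m \<omega>)) (atoms (m \<omega>)) \<longleftrightarrow> (\<forall>y\<in>atoms (m \<omega>). in_degree \<omega> y = 1)"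
    if \<omega>: "\<omega> \<in> space P" and into: "\<forall>x\<in>atoms (m \<omega>). H \<omega> x \<in> atoms (m \<omega>)" for \<omega>
  proof -
    have "in_degree \<omega> y = 1 \<longleftrightarrow> (\<exists>!x. x \<in> atoms (m \<omega>) \<and> H \<omega> x = y)" for y
    proof -
      let ?S = "{x \<in> atoms (m \<omega>). H \<omega> x = y}"
      have "in_degree \<omega> y = 1 \<longleftrightarrow> card ?S = 1"
      proof (cases "finite ?S")
        case True
        have "in_degree \<omega> y = of_nat (card ?S)"
          using True by (simp add: in_degree_eq_emeasure[OF \<omega>] emeasure_count_space)
        then show ?thesis by simp
      qed (simp add: in_degree_eq_emeasure[OF \<omega>] emeasure_count_space)
      then show ?thesis by (simp add: card_1_singleton_iff set_eq_iff Ex1_def) blast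
    qed
    then show ?thesis by (simp only: bij_betw_iff_ex1_preimage[OF into])
  qed
  have "AE \<omega> in P. bij_betw (H \<omega>) (atoms (m \<omega>)) (atoms (m \<omega>)) \<longleftrightarrow>
      (\<forall>y\<in>atoms (m \<omega>). in_degree \<omega> y = 1)"
    using AE_point_shift_atoms AE_space by eventually_elim (rule pointwise)
  then show ?thesis
    unfolding bijective_point_shift_def by (rule eventually_subst)
qed

text \<open>
  Double counting: write the summand at \<open>x\<close> as a sum over all points \<open>y\<close> of which only
  \<open>y = H \<omega> x\<close> contributes, and exchange the two sums.
\<close>

lemma nn_integral_image_eq_in_degree:
  assumes f [measurable]: "(\<lambda>(\<omega>, y). f \<omega> y) \<in> borel_measurable (P \<Otimes>\<^sub>M borel)"
  shows "(\<integral>\<^sup>+\<omega>. \<integral>\<^sup>+x. f \<omega> (H \<omega> x) \<partial>m \<omega> \<partial>P) = (\<integral>\<^sup>+\<omega>. \<integral>\<^sup>+y. f \<omega> y * in_degree \<omega> y \<partial>m \<omega> \<partial>P)"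
proof (rule nn_integral_cong_AE)
  show "AE \<omega> in P. (\<integral>\<^sup>+x. f \<omega> (H \<omega> x) \<partial>m \<omega>) = (\<integral>\<^sup>+y. f \<omega> y * in_degree \<omega> y \<partial>m \<omega>)"
    using AE_point_shift_atoms AE_space
  proof eventually_elim
    fix \<omega> assume into: "\<forall>x\<in>atoms (m \<omega>). H \<omega> x \<in> atoms (m \<omega>)" and \<omega> [measurable]: "\<omega> \<in> space P"
    note [measurable_cong] = sets_process[OF \<omega>]
    note sum = nn_integral_simple_counting_measure[OF simple_counting[OF \<omega>]]
    interpret m: sigma_finite_measure "m \<omega>" by (rule sigma_finite_process[OF \<omega>])
    interpret mm: pair_sigma_finite "m \<omega>" "m \<omega>" ..
    have "(\<integral>\<^sup>+x. f \<omega> (H \<omega> x) \<partial>m \<omega>) = (\<integral>\<^sup>+x. f \<omega> (H \<omega> x) \<partial>count_space (atoms (m \<omega>)))"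
      by (rule sum) measurable
    also have "\<dots> = (\<integral>\<^sup>+x. \<integral>\<^sup>+y. f \<omega> y * indicator {y} (H \<omega> x) \<partial>m \<omega> \<partial>count_space (atoms (m \<omega>)))"
    proof (rule nn_integral_cong)
      fix x assume "x \<in> space (count_space (atoms (m \<omega>)))"
      then have x: "H \<omega> x \<in> atoms (m \<omega>)" using into by simp
      have "(\<integral>\<^sup>+y. f \<omega> y * indicator {y} (H \<omega> x) \<partial>m \<omega>)
          = (\<integral>\<^sup>+y. f \<omega> y * indicator {y} (H \<omega> x) \<partial>count_space (atoms (m \<omega>)))"
        by (rule sum) measurable
      also have "\<dots> = (\<integral>\<^sup>+y. f \<omega> y * indicator {H \<omega> x} y \<partial>count_space (atoms (m \<omega>)))"
        by (intro nn_integral_cong) (auto split: split_indicator)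
      also have "\<dots> = f \<omega> (H \<omega> x)"
        using x by (subst nn_integral_indicator_singleton) simp_all
      finally show "f \<omega> (H \<omega> x) = (\<integral>\<^sup>+y. f \<omega> y * indicator {y} (H \<omega> x) \<partial>m \<omega>)" ..
    qed
    also have "\<dots> = (\<integral>\<^sup>+x. \<integral>\<^sup>+y. f \<omega> y * indicator {y} (H \<omega> x) \<partial>m \<omega> \<partial>m \<omega>)"
      by (rule sum[symmetric]) measurable
    also have "\<dots> = (\<integral>\<^sup>+y. \<integral>\<^sup>+x. f \<omega> y * indicator {y} (H \<omega> x) \<partial>m \<omega> \<partial>m \<omega>)"
      by (rule mm.Fubini') measurable
    also have "\<dots> = (\<integral>\<^sup>+y. f \<omega> y * in_degree \<omega> y \<partial>m \<omega>)"
      unfolding in_degree_def by (intro nn_integral_cong nn_integral_cmult) measurable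
    finally show "(\<integral>\<^sup>+x. f \<omega> (H \<omega> x) \<partial>m \<omega>) = (\<integral>\<^sup>+y. f \<omega> y * in_degree \<omega> y \<partial>m \<omega>)" .
  qed
qed

text \<open>
  Moving the origin to \<open>x\<close> and then applying the point-map moves it to \<open>H \<omega> x\<close>. The
  indicator \<open>1[\<theta> (- H \<omega> x) \<omega> \<in> A]\<close> is invariant, so that \<open>mass_transport\<close> applies
  to the weight.
\<close>

lemma palm_measure_shifted:
  fixes w :: "'x \<Rightarrow> real"
  assumes w [measurable]: "w \<in> borel_measurable borel"
    and w_1: "(\<integral>\<^sup>+z. ennreal (w z) \<partial>\<nu>) = 1" and w_refl: "(\<integral>\<^sup>+z. ennreal (w (- z)) \<partial>\<nu>) = 1"
    and A [measurable]: "A \<in> sets P"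
  shows "emeasure (palm_measure P \<theta> m \<gamma> w) {\<omega> \<in> space P. \<theta> (- point_map H \<omega>) \<omega> \<in> A}
    = (\<integral>\<^sup>+\<omega>. \<integral>\<^sup>+y. indicator A (\<theta> (- y) \<omega>) * in_degree \<omega> y * ennreal (w y) \<partial>m \<omega> \<partial>P) / \<gamma>"
proof -
  let ?A' = "{\<omega> \<in> space P. \<theta> (- point_map H \<omega>) \<omega> \<in> A}"
  have A' [measurable]: "?A' \<in> sets P"
    unfolding point_map_def by measurable
  have shift: "indicator ?A' (\<theta> (- x) \<omega>) = (indicator A (\<theta> (- H \<omega> x) \<omega>) :: ennreal)"
    if \<omega>: "\<omega> \<in> space P" for \<omega> x
  proof -
    have "point_map H (\<theta> (- x) \<omega>) = - x + H \<omega> x"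
      using point_shift_action[OF \<omega>, of "- x" x] by (simp add: point_map_def)
    then have "\<theta> (- point_map H (\<theta> (- x) \<omega>)) (\<theta> (- x) \<omega>) = \<theta> (- H \<omega> x) \<omega>"
      by (simp add: action_add[OF \<omega>] minus_add add.assoc)
    then show ?thesis
      using action_in_space[OF \<omega>] by (simp add: indicator_def)
  qed
  have inv: "\<theta> (- (z + y)) (\<theta> z \<omega>) = \<theta> (- y) \<omega>" if "\<omega> \<in> space P" for \<omega> z y
    using that by (simp add: action_add minus_add add.assoc)
  have "(\<integral>\<^sup>+\<omega>. \<integral>\<^sup>+x. indicator ?A' (\<theta> (- x) \<omega>) * ennreal (w x) \<partial>m \<omega> \<partial>P)
      = (\<integral>\<^sup>+\<omega>. \<integral>\<^sup>+x. indicator A (\<theta> (- H \<omega> x) \<omega>) * ennreal (w x) \<partial>m \<omega> \<partial>P)"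
    by (intro nn_integral_cong) (simp only: shift)
  also have "\<dots> = (\<integral>\<^sup>+\<omega>. \<integral>\<^sup>+x. indicator A (\<theta> (- H \<omega> x) \<omega>) * ennreal (w (H \<omega> x)) \<partial>m \<omega> \<partial>P)"
    using mass_transport[of "\<lambda>\<omega> x. indicator A (\<theta> (- H \<omega> x) \<omega>)" H "\<lambda>x. ennreal (w x)" "\<lambda>x. ennreal (w x)"]
    by (simp add: w_1 w_refl point_shift_action inv)
  also have "\<dots> = (\<integral>\<^sup>+\<omega>. \<integral>\<^sup>+y. indicator A (\<theta> (- y) \<omega>) * ennreal (w y) * in_degree \<omega> y \<partial>m \<omega> \<partial>P)"
    by (rule nn_integral_image_eq_in_degree) measurable
  also have "\<dots> = (\<integral>\<^sup>+\<omega>. \<integral>\<^sup>+y. indicator A (\<theta> (- y) \<omega>) * in_degree \<omega> y * ennreal (w y) \<partial>m \<omega> \<partial>P)"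
    by (simp add: mult_ac)
  finally show ?thesis
    by (simp add: emeasure_palm_measure[OF locally_compact stationary simple w A'])
qed

text \<open>
  This is the uniqueness of densities for the Palm measure, carried out on the two events that
  matter. Where the origin has in-degree 0 the reweighted measure is zero, and where it has in-degree at least 2 it is at
  least twice the original one; if both measures agree and are finite, these events are null.
\<close>

lemma in_degree_reweighting_trivial_iff:
  fixes w :: "'x \<Rightarrow> ennreal"
  assumes w [measurable]: "w \<in> borel_measurable borel" and w_pos: "(\<integral>\<^sup>+z. w z \<partial>\<nu>) \<noteq> 0"
    and w_fin: "(\<integral>\<^sup>+\<omega>. \<integral>\<^sup>+x. w x \<partial>m \<omega> \<partial>P) < \<infinity>"
  shows "(\<forall>A\<in>sets P. (\<integral>\<^sup>+\<omega>. \<integral>\<^sup>+y. indicator A (\<theta> (- y) \<omega>) * in_degree \<omega> y * w y \<partial>m \<omega> \<partial>P)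
      = (\<integral>\<^sup>+\<omega>. \<integral>\<^sup>+y. indicator A (\<theta> (- y) \<omega>) * w y \<partial>m \<omega> \<partial>P))
    \<longleftrightarrow> (AE \<omega> in P. \<forall>y\<in>atoms (m \<omega>). in_degree \<omega> y = 1)"
proof -
  define palm where "palm A = (\<integral>\<^sup>+\<omega>. \<integral>\<^sup>+y. indicator A (\<theta> (- y) \<omega>) * w y \<partial>m \<omega> \<partial>P)" for A
  define palm_in where "palm_in A =
    (\<integral>\<^sup>+\<omega>. \<integral>\<^sup>+y. indicator A (\<theta> (- y) \<omega>) * in_degree \<omega> y * w y \<partial>m \<omega> \<partial>P)" for A
  have "(\<forall>A\<in>sets P. palm_in A = palm A) \<longleftrightarrow> (AE \<omega> in P. \<forall>y\<in>atoms (m \<omega>). in_degree \<omega> y = 1)"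
  proof
    assume "AE \<omega> in P. \<forall>y\<in>atoms (m \<omega>). in_degree \<omega> y = 1"
    then have "AE \<omega> in P. (\<integral>\<^sup>+y. indicator A (\<theta> (- y) \<omega>) * in_degree \<omega> y * w y \<partial>m \<omega>)
      = (\<integral>\<^sup>+y. indicator A (\<theta> (- y) \<omega>) * w y \<partial>m \<omega>)" if [measurable]: "A \<in> sets P" for A
      using AE_space
    proof eventually_elim
      fix \<omega> assume 1: "\<forall>y\<in>atoms (m \<omega>). in_degree \<omega> y = 1" and \<omega> [measurable]: "\<omega> \<in> space P"
      note sum = nn_integral_simple_counting_measure[OF simple_counting[OF \<omega>]]
      have "(\<integral>\<^sup>+y. indicator A (\<theta> (- y) \<omega>) * in_degree \<omega> y * w y \<partial>m \<omega>)
        = (\<integral>\<^sup>+y. indicator A (\<theta> (- y) \<omega>) * in_degree \<omega> y * w y \<partial>count_space (atoms (m \<omega>)))"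
        by (rule sum) measurable
      also have "\<dots> = (\<integral>\<^sup>+y. indicator A (\<theta> (- y) \<omega>) * w y \<partial>count_space (atoms (m \<omega>)))"
        using 1 by (intro nn_integral_cong) simp
      also have "\<dots> = (\<integral>\<^sup>+y. indicator A (\<theta> (- y) \<omega>) * w y \<partial>m \<omega>)"
        by (rule sum[symmetric]) measurable
      finally show "(\<integral>\<^sup>+y. indicator A (\<theta> (- y) \<omega>) * in_degree \<omega> y * w y \<partial>m \<omega>)
        = (\<integral>\<^sup>+y. indicator A (\<theta> (- y) \<omega>) * w y \<partial>m \<omega>)" .
    qed
    then show "\<forall>A\<in>sets P. palm_in A = palm A"
      unfolding palm_in_def palm_def by (intro ballI nn_integral_cong_AE)
  next
    assume eq: "\<forall>A\<in>sets P. palm_in A = palm A"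
    \<comment> \<open>A set of in-degrees that is null for the origin under the Palm measure is avoided by all points.\<close>
    have AE_avoid: "AE \<omega> in P. \<forall>y\<in>atoms (m \<omega>). in_degree \<omega> y \<notin> T"
      if T [measurable]: "T \<in> sets borel" and null: "palm {\<omega> \<in> space P. in_degree \<omega> 0 \<in> T} = 0" for T
    proof -
      have "palm {\<omega> \<in> space P. in_degree \<omega> 0 \<in> T}
          = (\<integral>\<^sup>+\<omega>. \<integral>\<^sup>+y. indicator T (in_degree \<omega> y) * w y \<partial>m \<omega> \<partial>P)"
        unfolding palm_def
        by (intro nn_integral_cong) (simp add: indicator_def in_degree_origin action_in_space)
      then have "AE \<omega> in P. \<forall>y\<in>atoms (m \<omega>). indicator T (in_degree \<omega> y) = (0::ennreal)"
        using null w_pos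
        by (intro AE_atoms_eq_0[of _ w]) (simp_all add: in_degree_action)
      then show ?thesis by eventually_elim (auto simp: indicator_def split: if_splits)
    qed
    let ?A0 = "{\<omega> \<in> space P. in_degree \<omega> 0 \<in> {0}}" and ?A2 = "{\<omega> \<in> space P. in_degree \<omega> 0 \<in> {2..}}"
    have "palm ?A0 = palm_in ?A0"
      using eq by simp
    also have "\<dots> = 0"
      unfolding palm_in_def
      by (intro nn_integral_zero' AE_I2) (auto simp: in_degree_origin split: split_indicator intro!: nn_integral_zero')
    finally have A0: "palm ?A0 = 0" .
    have "palm ?A2 \<le> (\<integral>\<^sup>+\<omega>. \<integral>\<^sup>+x. w x \<partial>m \<omega> \<partial>P)"
      unfolding palm_def by (intro nn_integral_mono) (simp split: split_indicator)
    then have fin: "palm ?A2 \<noteq> \<top>"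
      using w_fin by (auto simp: top_unique)
    have "palm ?A2 + palm ?A2 \<le> palm_in ?A2"
    proof -
      have [measurable]: "?A2 \<in> sets P" by measurable
      have "palm ?A2 + palm ?A2 = (\<integral>\<^sup>+\<omega>. (\<integral>\<^sup>+y. indicator ?A2 (\<theta> (- y) \<omega>) * w y \<partial>m \<omega>)
          + (\<integral>\<^sup>+y. indicator ?A2 (\<theta> (- y) \<omega>) * w y \<partial>m \<omega>) \<partial>P)"
        unfolding palm_def by (rule nn_integral_add[symmetric]) measurable
      also have "\<dots> \<le> palm_in ?A2"
        unfolding palm_in_def
      proof (rule nn_integral_mono)
        fix \<omega> assume \<omega> [measurable]: "\<omega> \<in> space P"
        note [measurable_cong] = sets_process[OF \<omega>]
        have "(\<integral>\<^sup>+y. indicator ?A2 (\<theta> (- y) \<omega>) * w y \<partial>m \<omega>)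
            + (\<integral>\<^sup>+y. indicator ?A2 (\<theta> (- y) \<omega>) * w y \<partial>m \<omega>)
          = (\<integral>\<^sup>+y. indicator ?A2 (\<theta> (- y) \<omega>) * w y + indicator ?A2 (\<theta> (- y) \<omega>) * w y \<partial>m \<omega>)"
          by (rule nn_integral_add[symmetric]) measurable
        also have "\<dots> \<le> (\<integral>\<^sup>+y. indicator ?A2 (\<theta> (- y) \<omega>) * in_degree \<omega> y * w y \<partial>m \<omega>)"
        proof (rule nn_integral_mono)
          fix y
          show "indicator ?A2 (\<theta> (- y) \<omega>) * w y + indicator ?A2 (\<theta> (- y) \<omega>) * w y
            \<le> indicator ?A2 (\<theta> (- y) \<omega>) * in_degree \<omega> y * w y"
            using mult_right_mono[of 2 "in_degree \<omega> y" "w y"]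
            by (simp add: in_degree_origin[OF \<omega>] mult_2 split: split_indicator)
        qed
        finally show "(\<integral>\<^sup>+y. indicator ?A2 (\<theta> (- y) \<omega>) * w y \<partial>m \<omega>)
            + (\<integral>\<^sup>+y. indicator ?A2 (\<theta> (- y) \<omega>) * w y \<partial>m \<omega>)
          \<le> (\<integral>\<^sup>+y. indicator ?A2 (\<theta> (- y) \<omega>) * in_degree \<omega> y * w y \<partial>m \<omega>)" .
      qed
      finally show ?thesis .
    qed
    also have "\<dots> = palm ?A2 + 0"
      using eq by simp
    finally have A2: "palm ?A2 = 0"
      using fin by (simp add: ennreal_add_left_cancel_le)
    have "AE \<omega> in P. \<forall>y\<in>atoms (m \<omega>). in_degree \<omega> y \<notin> {0}"
      by (rule AE_avoid[OF _ A0]) simp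
    moreover have "AE \<omega> in P. \<forall>y\<in>atoms (m \<omega>). in_degree \<omega> y \<notin> {2..}"
      by (rule AE_avoid[OF _ A2]) simp
    ultimately show "AE \<omega> in P. \<forall>y\<in>atoms (m \<omega>). in_degree \<omega> y = 1"
      using AE_space
    proof eventually_elim
      fix \<omega> assume 0: "\<forall>y\<in>atoms (m \<omega>). in_degree \<omega> y \<notin> {0}"
        and 2: "\<forall>y\<in>atoms (m \<omega>). in_degree \<omega> y \<notin> {2..}" and \<omega>: "\<omega> \<in> space P"
      show "\<forall>y\<in>atoms (m \<omega>). in_degree \<omega> y = 1"
      proof
        fix y assume "y \<in> atoms (m \<omega>)"
        then have "in_degree \<omega> y \<noteq> 0" "\<not> 2 \<le> in_degree \<omega> y"
          using 0 2 by simp_all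
        then show "in_degree \<omega> y = 1"
          by (cases rule: in_degree_cases[OF \<omega>, of y]) simp_all
      qed
    qed
  qed
  then show ?thesis unfolding palm_in_def palm_def .
qed

end

theorem corollary4p1:
  fixes \<nu> :: "'x::{topological_group_add, second_countable_topology, t2_space} measure"
    and P :: "'w measure"
    and \<theta> :: "'x \<Rightarrow> 'w \<Rightarrow> 'w"
    and m :: "'w \<Rightarrow> 'x measure"
    and H :: "'w \<Rightarrow> 'x \<Rightarrow> 'x"
    and B :: "'x set"
    and w :: "'x \<Rightarrow> real"
  assumes "locally_compact_space (euclidean :: 'x topology)"
    and "left_haar_measure \<nu>"
    and "right_invariant \<nu>"
    and "stationary_framework P \<theta>"
    and "simple_point_process P m"
    and "flow_adapted P \<theta> m"
    and "B \<in> sets borel" and "0 < emeasure \<nu> B" and "emeasure \<nu> B < \<infinity>"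
    and "0 < intensity P m \<nu> B" and "intensity P m \<nu> B < \<infinity>"
    and "w \<in> borel_measurable borel" and "\<forall>x. 0 \<le> w x" and "(\<integral>\<^sup>+x. ennreal (w x) \<partial>\<nu>) = 1"
    and "point_shift P \<theta> m H"
  shows "(\<forall>A\<in>sets P.
            emeasure (palm_measure P \<theta> m (intensity P m \<nu> B) w)
              {\<omega> \<in> space P. \<theta> (- point_map H \<omega>) \<omega> \<in> A}
            = emeasure (palm_measure P \<theta> m (intensity P m \<nu> B) w) A)
         \<longleftrightarrow> bijective_point_shift P m H"
proof -
  interpret unimodular_point_shift \<nu> P \<theta> m H
    by unfold_locales (fact assms)+
  define \<gamma> where "\<gamma> = intensity P m \<nu> B"
  note w [measurable] = assms(12) and w_1 = assms(14)
  have w_refl: "(\<integral>\<^sup>+z. ennreal (w (- z)) \<partial>\<nu>) = 1"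
    and w_fin: "(\<integral>\<^sup>+\<omega>. \<integral>\<^sup>+x. ennreal (w x) \<partial>m \<omega> \<partial>P) < \<infinity>"
    using weight_normalisation[OF assms(7-11), of "\<lambda>x. ennreal (w x)"] w_1 by simp_all
  have \<gamma>: "x / \<gamma> = y / \<gamma> \<longleftrightarrow> x = y" for x y
    using assms(10,11)
    by (auto simp: \<gamma>_def divide_ennreal_def mult.commute[of _ "inverse _"] ennreal_mult_cancel_left)
  have "emeasure (palm_measure P \<theta> m \<gamma> w) {\<omega> \<in> space P. \<theta> (- point_map H \<omega>) \<omega> \<in> A}
      = emeasure (palm_measure P \<theta> m \<gamma> w) A
    \<longleftrightarrow> (\<integral>\<^sup>+\<omega>. \<integral>\<^sup>+y. indicator A (\<theta> (- y) \<omega>) * in_degree \<omega> y * ennreal (w y) \<partial>m \<omega> \<partial>P)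
      = (\<integral>\<^sup>+\<omega>. \<integral>\<^sup>+y. indicator A (\<theta> (- y) \<omega>) * ennreal (w y) \<partial>m \<omega> \<partial>P)"
    if A: "A \<in> sets P" for A
    unfolding palm_measure_shifted[OF w w_1 w_refl A]
      emeasure_palm_measure[OF locally_compact stationary simple w A] by (rule \<gamma>)
  then show ?thesis
    unfolding bijective_iff_in_degree \<gamma>_def[symmetric]
    using in_degree_reweighting_trivial_iff[OF _ _ w_fin] w_1 by simp
qed

end
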